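(* For every $\alpha\in\mathbb{R}$, the distribution $BASN_2(\alpha)$ has at most two modes.
   Context: Here $\varphi(z) = \frac{1}{\sqrt{2\pi}} e^{-z^2/2}$ is the standard normal probability density function. For $\alpha\in\mathbb{R}$, put $C_2(\alpha) = 3 - \frac{4}{2+\alpha^2}$. The Balakrishnan alpha skew normal distribution with parameter $\alpha$, written $BASN_2(\alpha)$, is the distribution on $\mathbb{R}$ with probability density function $$f_Z(z;\alpha) = \frac{1}{C_2(\alpha)}\left(\frac{(1-\alpha z)^2+1}{2+\alpha^2}\right)^2\varphi(z),\qquad z\in\mathbb{R}.$$ A mode is a point of $\mathbb{R}$ at which the density $f_Z(\cdot;\alpha)$ attains a local maximum. *)

theory Defs
  imports "HOL-Probability.Probability"
begin

definition C2 :: "real \<Rightarrow> real" where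
  "C2 \<alpha> = 3 - 4 / (2 + \<alpha>\<^sup>2)"

definition BASN2_density :: "real \<Rightarrow> real \<Rightarrow> real" where
  "BASN2_density \<alpha> z =
     1 / C2 \<alpha> * (((1 - \<alpha> * z)\<^sup>2 + 1) / (2 + \<alpha>\<^sup>2))\<^sup>2 * std_normal_density z"

text \<open>Local maxima are not required to be strict.\<close>

definition is_local_max :: "('a::topological_space \<Rightarrow> real) \<Rightarrow> 'a \<Rightarrow> bool" where
  "is_local_max f x \<longleftrightarrow> (\<forall>\<^sub>F y in nhds x. f y \<le> f x)"

definition BASN2_modes :: "real \<Rightarrow> real set" where
  "BASN2_modes \<alpha> = {z. is_local_max (BASN2_density \<alpha>) z}"

end

theory Submission
  imports Defs
begin

text \<open>
  Write \<open>q z = (1 - \<alpha> z)\<^sup>2 + 1\<close>. Up to a positive constant the density is \<open>q\<^sup>2 \<phi>\<close>, and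
  \<open>\<phi>' z = - z \<phi> z\<close>, so its derivative is \<open>q \<phi>\<close> times the polynomial \<open>2 q' - z q\<close>. As \<open>q \<phi>\<close> is
  positive, the sign of the derivative is that of this polynomial, whose degree is at most three and
  whose cubic coefficient is \<open>- \<alpha>\<^sup>2\<close>.

  Modes are critical points, hence roots of the polynomial. Three modes \<open>a < b < c\<close> would be all of
  its roots and force it to be \<open>- \<alpha>\<^sup>2 (z - a) (z - b) (z - c)\<close> with \<open>\<alpha> \<noteq> 0\<close>
  (lemma \<open>score_three_roots\<close>). This is negative on \<open>(a, b)\<close>, so the density decreases strictly up to
  \<open>b\<close>, and \<open>b\<close> is not a local maximum.
\<close>

text \<open>The polynomial \<open>2 q' - z q\<close>; for \<open>\<alpha> = 0\<close> it is linear.\<close>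

definition score_poly :: "real \<Rightarrow> real \<Rightarrow> real" where
  "score_poly \<alpha> z = - 4 * \<alpha> * (1 - \<alpha> * z) - z * ((1 - \<alpha> * z)\<^sup>2 + 1)"

definition BASN2_const :: "real \<Rightarrow> real" where
  "BASN2_const \<alpha> = 1 / (C2 \<alpha> * (2 + \<alpha>\<^sup>2)\<^sup>2 * sqrt (2 * pi))"

lemma BASN2_const_pos: "BASN2_const \<alpha> > 0"
proof -
  have pos: "2 + \<alpha>\<^sup>2 > 0"
    using zero_le_power2[of \<alpha>] by linarith
  then have "C2 \<alpha> > 0"
    by (simp add: C2_def field_simps add_pos_nonneg)
  with pos show ?thesis
    by (simp add: BASN2_const_def)
qed

lemma BASN2_density_eq:
  "BASN2_density \<alpha> z = BASN2_const \<alpha> * ((1 - \<alpha> * z)\<^sup>2 + 1)\<^sup>2 * exp (- z\<^sup>2 / 2)"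
  by (simp add: BASN2_density_def BASN2_const_def std_normal_density_def power_divide)

lemma BASN2_density_deriv:
  "(BASN2_density \<alpha> has_real_derivative
     BASN2_const \<alpha> * ((1 - \<alpha> * z)\<^sup>2 + 1) * exp (- z\<^sup>2 / 2) * score_poly \<alpha> z) (at z)"
  unfolding BASN2_density_eq[abs_def] score_poly_def
  by (rule derivative_eq_intros refl | simp)+
     (simp add: algebra_simps power2_eq_square power3_eq_cube)

lemma density_factor_pos:
  "BASN2_const \<alpha> * ((1 - \<alpha> * z)\<^sup>2 + 1) * exp (- z\<^sup>2 / 2) > 0"
  by (intro mult_pos_pos BASN2_const_pos) (auto simp: add_nonneg_pos)

lemma mode_imp_root:
  assumes "x \<in> BASN2_modes \<alpha>"
  shows "score_poly \<alpha> x = 0"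
proof -
  from assms obtain d where d: "d > 0" "\<And>y. dist y x < d \<Longrightarrow> BASN2_density \<alpha> y \<le> BASN2_density \<alpha> x"
    unfolding BASN2_modes_def is_local_max_def eventually_nhds_metric by auto
  have "BASN2_const \<alpha> * ((1 - \<alpha> * x)\<^sup>2 + 1) * exp (- x\<^sup>2 / 2) * score_poly \<alpha> x = 0"
    using d by (intro DERIV_local_max[OF BASN2_density_deriv])
      (auto simp: dist_real_def abs_minus_commute)
  with density_factor_pos[of \<alpha> x] show ?thesis
    by (metis mult_eq_0_iff order_less_irrefl)
qed

lemma quadratic_three_roots_zero:
  fixes u v w :: "'a :: idom"
  assumes "a \<noteq> b" "a \<noteq> c" "b \<noteq> c"
    and "u * a\<^sup>2 + v * a + w = 0" "u * b\<^sup>2 + v * b + w = 0" "u * c\<^sup>2 + v * c + w = 0"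
  shows "u = 0" "v = 0" "w = 0"
proof -
  \<comment> \<open>first divided differences of the quadratic at the pairs of roots\<close>
  have "(a - b) * (u * (a + b) + v) = 0" "(a - c) * (u * (a + c) + v) = 0"
    using assms(4-6) by algebra+
  then have ab: "u * (a + b) + v = 0" and ac: "u * (a + c) + v = 0"
    using assms(1,2) by auto
  then have "u * (b - c) = 0"
    by algebra
  then show u: "u = 0"
    using assms(3) by simp
  with ab show v: "v = 0"
    by simp
  from u v assms(4) show "w = 0"
    by simp
qed

lemma score_three_roots:
  assumes "a < b" "b < c"
    and "score_poly \<alpha> a = 0" "score_poly \<alpha> b = 0" "score_poly \<alpha> c = 0"
  shows "\<alpha> \<noteq> 0" "score_poly \<alpha> z = - (\<alpha>\<^sup>2 * ((z - a) * (z - b) * (z - c)))"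
proof -
  show "\<alpha> \<noteq> 0"
    using assms by (auto simp: score_poly_def)
  \<comment> \<open>the cubic terms of the two sides agree, so their difference is a quadratic
     vanishing at \<open>a\<close>, \<open>b\<close> and \<open>c\<close>\<close>
  define u where "u = 2 * \<alpha> - \<alpha>\<^sup>2 * (a + b + c)"
  define v where "v = 4 * \<alpha>\<^sup>2 - 2 + \<alpha>\<^sup>2 * (a * b + a * c + b * c)"
  define w where "w = - 4 * \<alpha> - \<alpha>\<^sup>2 * (a * b * c)"
  have diff: "score_poly \<alpha> x + \<alpha>\<^sup>2 * ((x - a) * (x - b) * (x - c)) = u * x\<^sup>2 + v * x + w" for x
    unfolding score_poly_def u_def v_def w_def
    by (simp add: algebra_simps power2_eq_square)
  have "u = 0 \<and> v = 0 \<and> w = 0"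
    using quadratic_three_roots_zero[of a b c u v w] assms diff[of a] diff[of b] diff[of c] by auto
  with diff[of z] show "score_poly \<alpha> z = - (\<alpha>\<^sup>2 * ((z - a) * (z - b) * (z - c)))"
    by simp
qed

lemma not_local_max_if_decreasing_left:
  fixes f :: "real \<Rightarrow> real"
  assumes "a < b" and "\<And>x. a < x \<Longrightarrow> x < b \<Longrightarrow> f b < f x"
  shows "\<not> is_local_max f b"
proof
  assume "is_local_max f b"
  then have "\<forall>\<^sub>F x in at_left b. f x \<le> f b"
    unfolding is_local_max_def eventually_at_filter by (auto elim: eventually_mono)
  moreover have "\<forall>\<^sub>F x in at_left b. a < x \<and> x < b"
    using eventually_at_left_real[OF assms(1)] by simp
  ultimately have "\<forall>\<^sub>F x in at_left b. False"
    by eventually_elim (use assms(2) in force)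
  then show False
    by simp
qed

lemma no_three_modes:
  assumes "a < b" "b < c" "a \<in> BASN2_modes \<alpha>" "b \<in> BASN2_modes \<alpha>" "c \<in> BASN2_modes \<alpha>"
  shows False
proof -
  note roots = score_three_roots[OF assms(1,2) assms(3-5)[THEN mode_imp_root]]
  have neg: "score_poly \<alpha> z < 0" if "a < z" "z < b" for z
  proof -
    have "(z - a) * (z - b) * (z - c) > 0"
      using that assms(2) by (simp add: mult_neg_neg mult_pos_neg)
    with roots(1) show ?thesis
      by (simp add: roots(2)[of z])
  qed
  have "BASN2_density \<alpha> b < BASN2_density \<alpha> x" if "a < x" "x < b" for x
  proof (rule DERIV_neg_imp_decreasing_open[OF that(2)])
    show "\<exists>y. (BASN2_density \<alpha> has_real_derivative y) (at z) \<and> y < 0" if "x < z" "z < b" for z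
      using BASN2_density_deriv[of \<alpha> z] mult_pos_neg[OF density_factor_pos neg, of z] that \<open>a < x\<close>
      by force
    show "continuous_on {x..b} (BASN2_density \<alpha>)"
      using BASN2_density_deriv by (intro DERIV_continuous_on) (auto intro: DERIV_subset)
  qed
  with assms(1,4) show False
    using not_local_max_if_decreasing_left by (auto simp: BASN2_modes_def)
qed

lemma card_le_2_if_no_chain:
  fixes S :: "'a :: linorder set"
  assumes no_chain: "\<And>a b c. a < b \<Longrightarrow> b < c \<Longrightarrow> a \<in> S \<Longrightarrow> b \<in> S \<Longrightarrow> c \<in> S \<Longrightarrow> False"
  shows "finite S \<and> card S \<le> 2"
proof (rule ccontr)
  assume "\<not> (finite S \<and> card S \<le> 2)"
  then have "infinite S \<or> 3 \<le> card S"
    by auto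
  then obtain T where "T \<subseteq> S" "card T = 3"
    by (metis infinite_arbitrarily_large obtain_subset_with_card_n)
  then obtain x y z where "x \<in> S" "y \<in> S" "z \<in> S" "x \<noteq> y" "x \<noteq> z" "y \<noteq> z"
    by (auto simp: card_3_iff)
  then show False
    using no_chain by (metis linorder_neq_iff)
qed

theorem mainTheorem6:
  fixes \<alpha> :: real
  shows "finite (BASN2_modes \<alpha>) \<and> card (BASN2_modes \<alpha>) \<le> 2"
  using no_three_modes by (rule card_le_2_if_no_chain)

end
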